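(* Let $\mathbb{F}_q$ be a finite field with $q$ elements and characteristic different from $2$, and let $m,n$ be positive integers with $m\le n$. Then $$|\mathcal{P}_{(n,m,1),2}(\mathbb{F}_q)|=\sum_{j=0}^{m}N_q(n,j).$$
   Context: $\mathcal{P}_{(n,m,1),2}(\mathbb{F}_q)$ (the neuromanifold) is the set of all homogeneous quadratic polynomials in $\mathbb{F}_q[x_1,\dots,x_n]$ of the form $\sum_{s=1}^m b_s(a_{s1}x_1+\dots+a_{sn}x_n)^2$ with $a_{sj},b_s\in\mathbb{F}_q$ arbitrary. $N_q(n,j)$ denotes the number of symmetric $n\times n$ matrices of rank $j$ over $\mathbb{F}_q$, which (characteristic not $2$) is given by $$N_q(n,j)=\prod_{i=1}^{\lfloor j/2\rfloor}\frac{q^{2i}}{q^{2i}-1}\cdot\prod_{i=0}^{j-1}(q^{n-i}-1).$$ *)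

theory Defs
  imports "HOL-Analysis.Analysis" "HOL-Library.Poly_Mapping"
begin

text \<open>
  The polynomial ring over \<open>'a\<close> in the variables \<open>x\<^sub>i\<close>, \<open>i :: 'n\<close>: formal polynomials, not polynomial
  functions (the two differ over a finite field). A monomial is a finitely supported exponent
  function, and multiplication is the convolution product of \<open>poly_mapping\<close>.
\<close>

type_synonym ('n, 'a) mpolynomial = "('n \<Rightarrow>\<^sub>0 nat) \<Rightarrow>\<^sub>0 'a"

definition poly_const :: "'a::comm_ring_1 \<Rightarrow> ('n, 'a) mpolynomial" where
  "poly_const c = Poly_Mapping.single 0 c"

definition poly_var :: "'n \<Rightarrow> ('n, 'a::comm_ring_1) mpolynomial" where
  "poly_var i = Poly_Mapping.single (Poly_Mapping.single i 1) 1"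

definition linear_form :: "('n::finite \<Rightarrow> 'a::comm_ring_1) \<Rightarrow> ('n, 'a) mpolynomial" where
  "linear_form c = (\<Sum>i\<in>UNIV. poly_const (c i) * poly_var i)"

text \<open>
  The neuromanifold of architecture \<open>(n, m, 1)\<close>, \<open>n = CARD('n)\<close>, with activation \<open>t \<mapsto> t\<^sup>2\<close>. Every
  polynomial of the displayed form is homogeneous of degree 2 (or zero), so homogeneity is not
  imposed separately.
\<close>

definition neuromanifold :: "nat \<Rightarrow> ('n::finite, 'a::comm_ring_1) mpolynomial set" where
  "neuromanifold m =
     {f. \<exists>(a :: nat \<Rightarrow> 'n \<Rightarrow> 'a) (b :: nat \<Rightarrow> 'a).
           f = (\<Sum>s=1..m. poly_const (b s) * (linear_form (a s))\<^sup>2)}"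

definition num_sym_rank ::
    "'a::{finite,field} itself \<Rightarrow> 'n::finite itself \<Rightarrow> nat \<Rightarrow> nat" where
  "num_sym_rank _ _ j = card {A :: 'a^'n^'n. transpose A = A \<and> rank A = j}"

end

theory Submission
  imports Defs
begin

text \<open>
  In characteristic other than 2, a quadratic form determines its symmetric coefficient matrix.
  Under this correspondence a sum of \<open>m\<close> weighted squares of linear forms has a matrix whose rows
  lie in the span of the \<open>m\<close> coefficient vectors, so its rank is at most \<open>m\<close>. Conversely, a nonzero
  symmetric \<open>A\<close> has a vector \<open>v\<close> with \<open>c = v\<^sup>T A v \<noteq> 0\<close> by polarisation, and splitting off the
  rank-one matrix \<open>c\<^sup>-\<^sup>1 (A v) (A v)\<^sup>T\<close> lowers the rank, so \<open>A\<close> is a sum of \<open>rank A\<close> weighted squares.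
\<close>

text \<open>The polynomial x^T A x, written as a sum of single monomials so that its coefficients
  can be read off. For distinct i and j the entries at (i, j) and (j, i) land on the same
  monomial.\<close>

definition quadratic_form :: "'a::comm_ring_1^'n^'n \<Rightarrow> ('n::finite, 'a) mpolynomial" where
  "quadratic_form A = (\<Sum>i\<in>UNIV. \<Sum>j\<in>UNIV.
     Poly_Mapping.single (Poly_Mapping.single i 1 + Poly_Mapping.single j 1) (A $ i $ j))"

text \<open>The product M^T D M, where M has the rows \<open>a 1\<close>, ..., \<open>a m\<close>
  and D is diagonal with entries \<open>b 1\<close>, ..., \<open>b m\<close>.\<close>

definition square_sum_matrix ::
    "nat \<Rightarrow> (nat \<Rightarrow> 'a::comm_ring_1) \<Rightarrow> (nat \<Rightarrow> 'n \<Rightarrow> 'a) \<Rightarrow> 'a^'n^'n" where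
  "square_sum_matrix m b a = (\<chi> i j. \<Sum>s=1..m. b s * a s i * a s j)"

lemma two_neq_0_if_CHAR_neq_2:
  assumes "CHAR('a::field) \<noteq> 2"
  shows "(2::'a) \<noteq> 0"
proof
  assume "(2::'a) = 0"
  then have "of_nat 2 = (0::'a)" by simp
  then have "CHAR('a) dvd 2" by (simp only: of_nat_eq_0_iff_char_dvd)
  then have "CHAR('a) = Suc 0 \<or> CHAR('a) = 2"
    using prime_nat_iff two_is_prime_nat by auto
  with assms show False by simp
qed

text \<open>Commutativity leaves only the unordered pair of variables. Comparing exponents at the
  four indices involved recovers it.\<close>

lemma degree_two_monomial_eq_iff:
  "Poly_Mapping.single i (1::nat) + Poly_Mapping.single j 1
     = Poly_Mapping.single k 1 + Poly_Mapping.single l 1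
   \<longleftrightarrow> i = k \<and> j = l \<or> i = l \<and> j = k" (is "?L = ?R \<longleftrightarrow> _")
proof
  assume eq: "?L = ?R"
  have "Poly_Mapping.lookup ?L x = Poly_Mapping.lookup ?R x" for x by (simp only: eq)
  from this[of i] this[of j] this[of k] this[of l]
  show "i = k \<and> j = l \<or> i = l \<and> j = k"
    by (auto simp: lookup_add lookup_single when_def split: if_splits)
qed (auto simp: add.commute)

lemma lookup_quadratic_form:
  "Poly_Mapping.lookup (quadratic_form A) (Poly_Mapping.single k 1 + Poly_Mapping.single l 1)
     = A $ k $ l + (if k = l then 0 else A $ l $ k)"
proof -
  have "Poly_Mapping.lookup (quadratic_form A) (Poly_Mapping.single k 1 + Poly_Mapping.single l 1)
      = (\<Sum>(i, j)\<in>UNIV \<times> UNIV. if (i, j) \<in> {(k, l), (l, k)} then A $ i $ j else 0)"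
    unfolding quadratic_form_def lookup_sum lookup_single degree_two_monomial_eq_iff
    unfolding sum.cartesian_product
    by (intro sum.cong) (auto simp: when_def)
  \<comment> \<open>For \<open>k = l\<close> this set has one element, so the diagonal entry is
    counted once.\<close>
  also have "\<dots> = (\<Sum>(i, j)\<in>{(k, l), (l, k)}. A $ i $ j)"
    by (rule sum.mono_neutral_cong_right) (auto split: if_splits)
  finally show ?thesis by auto
qed

text \<open>The coefficient of a squared variable is a diagonal entry. By symmetry a mixed
  coefficient is twice an off-diagonal entry, and 2 can be cancelled.\<close>

lemma inj_on_quadratic_form:
  assumes "(2::'a::field) \<noteq> 0"
  shows "inj_on quadratic_form {A :: 'a^'n::finite^'n. transpose A = A}"
proof (rule inj_onI)
  fix A B :: "'a^'n^'n"
  assume "A \<in> {A. transpose A = A}" "B \<in> {A. transpose A = A}"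
    and eq: "quadratic_form A = quadratic_form B"
  then have sym: "A $ l $ k = A $ k $ l" "B $ l $ k = B $ k $ l" for k l
    by (auto simp: transpose_def vec_eq_iff)
  have "A $ k $ l = B $ k $ l" for k l
  proof (cases "k = l")
    case True
    then show ?thesis
      using lookup_quadratic_form[of A k l] lookup_quadratic_form[of B k l] eq by simp
  next
    case False
    then have "2 * A $ k $ l = 2 * B $ k $ l"
      using lookup_quadratic_form[of A k l] lookup_quadratic_form[of B k l] eq
      by (simp add: sym[of l k])
    then show ?thesis using assms by simp
  qed
  then show "A = B" by (simp add: vec_eq_iff)
qed

lemma weighted_square_linear_form:
  "poly_const b * (linear_form a)\<^sup>2 = quadratic_form (\<chi> i j. b * a i * a j)"
  unfolding linear_form_def poly_const_def poly_var_def quadratic_form_def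
  unfolding power2_eq_square sum_product
  unfolding sum_distrib_left by (simp add: mult_single mult.assoc)

lemma quadratic_form_0: "quadratic_form 0 = 0"
  by (simp add: quadratic_form_def)

lemma quadratic_form_add: "quadratic_form (A + B) = quadratic_form A + quadratic_form B"
  by (simp add: quadratic_form_def single_add sum.distrib)

lemma square_sum_matrix_0: "square_sum_matrix 0 b a = 0"
  by (simp add: square_sum_matrix_def vec_eq_iff)

lemma square_sum_matrix_Suc:
  "square_sum_matrix (Suc m) b a
     = square_sum_matrix m b a + (\<chi> i j. b (Suc m) * a (Suc m) i * a (Suc m) j)"
  by (simp add: square_sum_matrix_def vec_eq_iff)

text \<open>This allows a new square to be stored at index \<open>Suc m\<close> without disturbing
  the first \<open>m\<close> summands.\<close>

lemma square_sum_matrix_cong: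
  assumes "\<And>s. s \<in> {1..m} \<Longrightarrow> b s = b' s \<and> a s = a' s"
  shows "square_sum_matrix m b a = square_sum_matrix m b' a'"
  using assms by (simp add: square_sum_matrix_def)

lemma quadratic_form_square_sum_matrix:
  "quadratic_form (square_sum_matrix m b a)
     = (\<Sum>s=1..m. poly_const (b s) * (linear_form (a s))\<^sup>2)"
  by (induction m)
    (simp_all add: square_sum_matrix_0 square_sum_matrix_Suc quadratic_form_0 quadratic_form_add
      weighted_square_linear_form)

lemma neuromanifold_eq_image:
  "neuromanifold m = {quadratic_form (square_sum_matrix m b a) |b a. True}"
  unfolding neuromanifold_def quadratic_form_square_sum_matrix by blast

lemma transpose_square_sum_matrix: "transpose (square_sum_matrix m b a) = square_sum_matrix m b a"
  by (simp add: square_sum_matrix_def transpose_def vec_eq_iff mult_ac)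

lemma rank_square_sum_matrix_le:
  fixes a :: "nat \<Rightarrow> 'n::finite \<Rightarrow> 'a::field"
  shows "rank (square_sum_matrix m b a) \<le> m"
proof -
  define W where "W = (\<lambda>s. \<chi> j. a s j) ` {1..m}"
  have "row i (square_sum_matrix m b a) \<in> vec.span W" for i
  proof -
    have "row i (square_sum_matrix m b a) = (\<Sum>s=1..m. (b s * a s i) *s (\<chi> j. a s j))"
      by (simp add: vec_eq_iff row_def square_sum_matrix_def)
    also have "\<dots> \<in> vec.span W"
      by (intro vec.span_sum vec.span_scale vec.span_base) (auto simp: W_def)
    finally show ?thesis .
  qed
  then have "rows (square_sum_matrix m b a) \<subseteq> vec.span W"
    by (auto simp: rows_def)
  then have "rank (square_sum_matrix m b a) \<le> card W"
    unfolding row_rank_def_gen by (intro vec.dim_le_card) (auto simp: W_def)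
  \<comment> \<open>Coefficient vectors may coincide, so \<open>W\<close> can have fewer than
    \<open>m\<close> elements.\<close>
  also have "\<dots> \<le> m"
    using card_image_le[of "{1..m}"] by (simp add: W_def)
  finally show ?thesis .
qed

lemma symmetric_matrix_anisotropic_vector:
  fixes A :: "'a::field^'n::finite^'n"
  assumes two: "(2::'a) \<noteq> 0" and sym: "transpose A = A" and "A \<noteq> 0"
  obtains v where "(\<Sum>i\<in>UNIV. (A *v v) $ i * v $ i) \<noteq> 0"
proof -
  define q where "q v = (\<Sum>i\<in>UNIV. (A *v v) $ i * v $ i)" for v
  have sym': "A $ j $ i = A $ i $ j" for i j
    using sym by (auto simp: transpose_def vec_eq_iff)
  have basis: "(A *v axis j 1) $ i = A $ i $ j" for i j
    by (simp add: matrix_vector_mult_def axis_def if_distrib cong: if_cong)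
  have pick: "(\<Sum>i\<in>UNIV. f i * axis j 1 $ i) = f j" for f :: "'n \<Rightarrow> 'a" and j
    by (simp add: axis_def if_distrib cong: if_cong)
  have q_basis: "q (axis i 1) = A $ i $ i" for i
    by (simp add: q_def basis pick)
  have q_add: "q (axis i 1 + axis j 1) = A $ i $ i + A $ j $ j + 2 * A $ i $ j" for i j
    by (simp add: q_def matrix_vector_right_distrib basis distrib_left sum.distrib pick
        sym'[of j i])
  have "\<exists>v. q v \<noteq> 0"
  proof (rule ccontr)
    assume "\<nexists>v. q v \<noteq> 0"
    then have "q v = 0" for v by blast
    \<comment> \<open>Polarisation on basis vectors: \<open>q\<close> of a sum of two of them, minus
      \<open>q\<close> of each, is twice an entry of \<open>A\<close>.\<close>
    then have "2 * A $ i $ j = 0" for i j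
      using q_add[of i j] q_basis[of i] q_basis[of j] by simp
    with two have "A = 0" by (simp add: vec_eq_iff)
    with \<open>A \<noteq> 0\<close> show False by contradiction
  qed
  then show thesis using that by (auto simp: q_def)
qed

text \<open>The row space shrinks strictly: it stays inside that of \<open>A\<close>, but every new
  row is orthogonal to \<open>v\<close>, whereas \<open>A *v v\<close> lies in the row space of
  \<open>A\<close> and pairs with \<open>v\<close> to \<open>c\<close>, which is nonzero.\<close>

lemma rank_deflation_less:
  fixes A :: "'a::field^'n::finite^'n"
  assumes sym: "transpose A = A"
    and c: "c = (\<Sum>i\<in>UNIV. (A *v v) $ i * v $ i)" "c \<noteq> 0"
  shows "rank (A - (\<chi> i j. inverse c * (A *v v) $ i * (A *v v) $ j)) < rank A"
proof -
  define w where "w = A *v v"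
  define B where "B = A - (\<chi> i j. inverse c * w $ i * w $ j)"
  \<comment> \<open>\<open>A *v v\<close> lies in the column space, which is the row space by
    symmetry.\<close>
  have w: "w \<in> vec.span (rows A)"
    using matrix_vector_mult_in_columnspace_gen[of A v] sym
    by (metis columns_transpose w_def)
  have "row i B \<in> vec.span (rows A)" for i
  proof -
    have "row i B = row i A - (inverse c * w $ i) *s w"
      by (simp add: vec_eq_iff row_def B_def)
    also have "\<dots> \<in> vec.span (rows A)"
      by (intro vec.span_diff vec.span_scale w vec.span_base) (auto simp: rows_def)
    finally show ?thesis .
  qed
  then have sub: "vec.span (rows B) \<subseteq> vec.span (rows A)"
    by (intro vec.span_minimal) (auto simp: rows_def)
  \<comment> \<open>The factor \<open>inverse c\<close> cancels the pairing of \<open>w\<close> with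
    \<open>v\<close>, leaving \<open>w - w\<close>.\<close>
  have "B *v v = 0"
  proof -
    have "(B *v v) $ i
        = (\<Sum>j\<in>UNIV. A $ i $ j * v $ j) - inverse c * w $ i * (\<Sum>j\<in>UNIV. w $ j * v $ j)" for i
      by (simp add: B_def matrix_vector_mult_def left_diff_distrib sum_subtractf sum_distrib_left
          mult.assoc)
    then have "(B *v v) $ i = w $ i - inverse c * w $ i * (\<Sum>j\<in>UNIV. w $ j * v $ j)" for i
      by (simp add: w_def matrix_vector_mult_def)
    then show ?thesis using c by (simp add: vec_eq_iff flip: w_def)
  qed
  then have "(\<Sum>j\<in>UNIV. row i B $ j * v $ j) = 0" for i
    by (simp add: vec_eq_iff matrix_vector_mult_def row_def)
  then have "rows B \<subseteq> {x. (\<Sum>j\<in>UNIV. x $ j * v $ j) = 0}"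
    by (auto simp: rows_def)
  moreover have "vec.subspace {x. (\<Sum>j\<in>UNIV. x $ j * v $ j) = 0}"
    by (auto simp: vec.subspace_def distrib_right sum.distrib mult.assoc simp flip: sum_distrib_left)
  ultimately have "vec.span (rows B) \<subseteq> {x. (\<Sum>j\<in>UNIV. x $ j * v $ j) = 0}"
    by (rule vec.span_minimal)
  moreover have "(\<Sum>j\<in>UNIV. w $ j * v $ j) \<noteq> 0"
    using c by (simp add: w_def)
  ultimately have "w \<notin> vec.span (rows B)" by blast
  with sub w have "vec.span (rows B) \<subset> vec.span (rows A)" by blast
  then show ?thesis
    unfolding row_rank_def_gen by (metis B_def w_def vec.dim_psubset)
qed

text \<open>Induction on the bound \<open>m\<close> rather than on the exact rank, so that any
  strict drop in rank suffices for the induction hypothesis.\<close>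

lemma symmetric_matrix_is_square_sum:
  fixes A :: "'a::field^'n::finite^'n"
  assumes two: "(2::'a) \<noteq> 0" and "transpose A = A" and "rank A \<le> m"
  shows "\<exists>b a. A = square_sum_matrix m b a"
  using assms(2,3)
proof (induction m arbitrary: A)
  case 0
  then have "row i A = 0" for i
    by (auto simp: row_rank_def_gen rows_def)
  then show ?case
    by (auto simp: square_sum_matrix_0 vec_eq_iff row_def)
next
  case (Suc m)
  show ?case
  proof (cases "A = 0")
    \<comment> \<open>The zero matrix has no vector to split along; zero weights fill all the
      summands.\<close>
    case True
    then have "A = square_sum_matrix (Suc m) (\<lambda>_. 0) (\<lambda>_ _. 0)"
      by (simp add: square_sum_matrix_def vec_eq_iff)
    then show ?thesis by blast
  next
    case False
    obtain v where v: "(\<Sum>i\<in>UNIV. (A *v v) $ i * v $ i) \<noteq> 0"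
      using symmetric_matrix_anisotropic_vector[OF two Suc.prems(1) False] .
    define c where "c = (\<Sum>i\<in>UNIV. (A *v v) $ i * v $ i)"
    define R where "R = (\<chi> i j. inverse c * (A *v v) $ i * (A *v v) $ j)"
    have "rank (A - R) < rank A"
      using rank_deflation_less[OF Suc.prems(1) c_def] v by (simp add: R_def c_def)
    then have "rank (A - R) \<le> m" using Suc.prems(2) by simp
    moreover have "transpose (A - R) = A - R"
      using Suc.prems(1) by (simp add: transpose_def vec_eq_iff R_def mult_ac)
    ultimately obtain b a where ba: "A - R = square_sum_matrix m b a"
      using Suc.IH by blast
    have "A = square_sum_matrix m b a + R"
      by (simp flip: ba)
    also have "\<dots> = square_sum_matrix (Suc m) (b(Suc m := inverse c)) (a(Suc m := ($) (A *v v)))"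
      unfolding square_sum_matrix_Suc
      by (intro arg_cong2[where f = "(+)"] square_sum_matrix_cong) (auto simp: R_def)
    finally show ?thesis by blast
  qed
qed

theorem corollary3p3p1:
  fixes m :: nat
  assumes "CHAR('a::{finite,field}) \<noteq> 2"
    and "1 \<le> m"
    and "m \<le> CARD('n::finite)"
  shows "card (neuromanifold m :: ('n, 'a) mpolynomial set)
           = (\<Sum>j=0..m. num_sym_rank TYPE('a) TYPE('n) j)"
proof -
  define S where "S j = {A :: 'a^'n^'n. transpose A = A \<and> rank A = j}" for j
  have two: "(2::'a) \<noteq> 0"
    using assms(1) by (rule two_neq_0_if_CHAR_neq_2)
  \<comment> \<open>The decomposition gives one inclusion, symmetry and the rank bound the other.
    Counting polynomials thus becomes counting symmetric matrices by rank.\<close>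
  have "(\<Union>j\<in>{0..m}. S j) = {square_sum_matrix m b a |b a. True}"
    using symmetric_matrix_is_square_sum[OF two]
    by (auto simp: S_def transpose_square_sum_matrix rank_square_sum_matrix_le)
  then have "(neuromanifold m :: ('n, 'a) mpolynomial set) = quadratic_form ` (\<Union>j\<in>{0..m}. S j)"
    unfolding neuromanifold_eq_image by auto
  moreover have "inj_on quadratic_form (\<Union>j\<in>{0..m}. S j)"
    by (rule inj_on_subset[OF inj_on_quadratic_form[OF two]]) (auto simp: S_def)
  ultimately have "card (neuromanifold m :: ('n, 'a) mpolynomial set) = card (\<Union>j\<in>{0..m}. S j)"
    by (simp add: card_image)
  also have "\<dots> = (\<Sum>j=0..m. card (S j))"
    by (rule card_UN_disjoint) (auto simp: S_def)
  finally show ?thesis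
    by (simp add: S_def num_sym_rank_def)
qed

end
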